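(* Let $\widehat X\ge0$ be the solution of the SCARE $\mathcal R(X)=0$. Let $X_0\ge\widehat X$ (symmetric) be such that $A_c(X_0)-G_c(X_0)X_0$ is stable and $\mathcal R(X_0)\le0$. Suppose that $\{X_k\}_{k=0}^\infty$, with $X_k\ge0$ for all $k$, is a sequence generated from $X_0$ by the modified Newton iteration, i.e. for each $k\ge0$, $X_{k+1}$ is a symmetric solution $X$ of the Lyapunov equation $$A_{X_k}^{\top}X+XA_{X_k}=-\Pi_{X_k}(X_k)-M_{X_k}.$$ Then: (i) $X_k\ge X_{k+1}$, $X_k\ge\widehat X$ and $\mathcal R(X_k)\le0$ for each $k\ge0$; (ii) $\lim_{k\to\infty}X_k=\widehat X_+$, where $\widehat X_+\ge\widehat X$ is a solution of the SCARE $\mathcal R(X)=0$; (iii) $\sigma\big(A_c(\widehat X_+)-G_c(\widehat X_+)\widehat X_+\big)\subset\mathbb C_-\cup i\mathbb R$.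
   Context: Data: $A,A_0^i\in\mathbb R^{n\times n}$, $B,B_0^i\in\mathbb R^{n\times m}$ ($i=1,\dots,r$), $Q=Q^{\top}\in\mathbb R^{n\times n}$, $L\in\mathbb R^{n\times m}$, $R=R^{\top}\in\mathbb R^{m\times m}$ with $R>0$ and $Q-LR^{-1}L^{\top}\ge 0$. For symmetric matrices, $X\ge Y$ (resp. $X>Y$) means $X-Y$ is positive semidefinite (resp. positive definite). Standing assumptions throughout: (c1) there exists $F\in\mathbb R^{m\times n}$ such that the linear matrix differential equation $\frac{d}{dt}Z=(A+BF)^{\top}Z+Z(A+BF)+\sum_{i=1}^r(A_0^i+B_0^iF)^{\top}Z(A_0^i+B_0^iF)$ is exponentially stable; (c2) with $C^{\top}C=Q-LR^{-1}L^{\top}$, there exists a matrix $K$ such that $\frac{d}{dt}Z=(A^{\top}+C^{\top}K)^{\top}Z+Z(A^{\top}+C^{\top}K)+\sum_{i=1}^rA_0^iZA_0^{i\top}$ is exponentially stable. For symmetric $X\in\mathbb R^{n\times n}$: $\Pi_{11}(X)=\sum_{i=1}^r A_0^{i\top}XA_0^i$, $\Pi_{12}(X)=\sum_{i=1}^r A_0^{i\top}XB_0^i$, $\Pi_{22}(X)=\sum_{i=1}^r B_0^{i\top}XB_0^i$, $\Pi(X)=\begin{bmatrix}\Pi_{11}(X)&\Pi_{12}(X)\\ \Pi_{12}(X)^{\top}&\Pi_{22}(X)\end{bmatrix}$; $L_c(X)=L+\Pi_{12}(X)$, $R_c(X)=R+\Pi_{22}(X)$, $Q_c(X)=Q+\Pi_{11}(X)$.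 For $X\ge0$ one has $R_c(X)>0$ and $A_c(X)=A-BR_c(X)^{-1}L_c(X)^{\top}$, $G_c(X)=BR_c(X)^{-1}B^{\top}$, $H_c(X)=Q_c(X)-L_c(X)R_c(X)^{-1}L_c(X)^{\top}$, $\mathcal R(X)=A_c(X)^{\top}X+XA_c(X)-XG_c(X)X+H_c(X)$. The stochastic continuous-time algebraic Riccati equation (SCARE) is $\mathcal R(X)=0$. For $X_k\ge 0$ put $R_k=R_c(X_k)$, $S_{X_k}=X_kB+L_c(X_k)$, and $A_{X_k}=A-BR_k^{-1}S_{X_k}^{\top}=A_c(X_k)-G_c(X_k)X_k$, $\Pi_{X_k}(X)=\begin{bmatrix}I&-S_{X_k}R_k^{-1}\end{bmatrix}\Pi(X)\begin{bmatrix}I\\-R_k^{-1}S_{X_k}^{\top}\end{bmatrix}$, $M_{X_k}=\begin{bmatrix}I&-S_{X_k}R_k^{-1}\end{bmatrix}\begin{bmatrix}Q&L\\L^{\top}&R\end{bmatrix}\begin{bmatrix}I\\-R_k^{-1}S_{X_k}^{\top}\end{bmatrix}$. A square matrix is stable if all its eigenvalues lie in the open left half-plane $\mathbb C_-$; $\sigma(\cdot)$ is the spectrum. *)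

theory Defs
  imports "HOL-Analysis.Analysis"
begin

section \<open>Matrix notions\<close>

text \<open>Semidefiniteness includes symmetry. The Loewner order \<open>X \<ge> Y\<close> is written
  \<open>possemidef (X - Y)\<close>.\<close>

definition possemidef :: "real^'n^'n \<Rightarrow> bool" where
  "possemidef X \<longleftrightarrow> transpose X = X \<and> (\<forall>x. 0 \<le> x \<bullet> (X *v x))"

definition posdef :: "real^'n^'n \<Rightarrow> bool" where
  "posdef X \<longleftrightarrow> transpose X = X \<and> (\<forall>x. x \<noteq> 0 \<longrightarrow> 0 < x \<bullet> (X *v x))"

definition spectrum :: "real^'n^'n \<Rightarrow> complex set" where
  "spectrum X = {z. \<exists>v :: complex^'n. v \<noteq> 0 \<and> map_matrix complex_of_real X *v v = z *s v}"

definition stable :: "real^'n^'n \<Rightarrow> bool" where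
  "stable X \<longleftrightarrow> spectrum X \<subseteq> {z. Re z < 0}"

text \<open>Uniform exponential decay of all solutions on \<open>[0, \<infinity>)\<close> of the autonomous equation
  \<open>dZ/dt = f Z\<close>.\<close>

definition exponentially_stable :: "('v::real_normed_vector \<Rightarrow> 'v) \<Rightarrow> bool" where
  "exponentially_stable f \<longleftrightarrow>
    (\<exists>c>0. \<exists>\<alpha>>0. \<forall>Z :: real \<Rightarrow> 'v.
      (\<forall>t\<ge>0. (Z has_vector_derivative f (Z t)) (at t within {0..})) \<longrightarrow>
      (\<forall>t\<ge>0. norm (Z t) \<le> c * exp (- \<alpha> * t) * norm (Z 0)))"

text \<open>Block matrices \<open>[X Y]\<close> and \<open>[X; Y]\<close>, indexed by sum types.\<close>

definition hblock :: "'a^'n^'k \<Rightarrow> 'a^'m^'k \<Rightarrow> 'a^('n + 'm)^'k" where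
  "hblock X Y = (\<chi> i j. case j of Inl a \<Rightarrow> X $ i $ a | Inr b \<Rightarrow> Y $ i $ b)"

definition vblock :: "'a^'k^'n \<Rightarrow> 'a^'k^'m \<Rightarrow> 'a^'k^('n + 'm)" where
  "vblock X Y = (\<chi> i. case i of Inl a \<Rightarrow> X $ a | Inr b \<Rightarrow> Y $ b)"


section \<open>The stochastic continuous-time algebraic Riccati equation\<close>

text \<open>The locale carries no assumptions; it only fixes the data. Only \<open>A0 i\<close> and \<open>B0 i\<close> with
  \<open>1 \<le> i \<le> r\<close> are used.\<close>

locale scare =
  fixes r :: nat
    and A :: "real^'n^'n" and B :: "real^'m^'n"
    and A0 :: "nat \<Rightarrow> real^'n^'n" and B0 :: "nat \<Rightarrow> real^'m^'n"
    and Q :: "real^'n^'n" and L :: "real^'m^'n" and R :: "real^'m^'m"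
begin

definition Pi11 :: "real^'n^'n \<Rightarrow> real^'n^'n" where
  "Pi11 X = (\<Sum>i=1..r. transpose (A0 i) ** X ** A0 i)"

definition Pi12 :: "real^'n^'n \<Rightarrow> real^'m^'n" where
  "Pi12 X = (\<Sum>i=1..r. transpose (A0 i) ** X ** B0 i)"

definition Pi22 :: "real^'n^'n \<Rightarrow> real^'m^'m" where
  "Pi22 X = (\<Sum>i=1..r. transpose (B0 i) ** X ** B0 i)"

definition Pi_op :: "real^'n^'n \<Rightarrow> real^('n + 'm)^('n + 'm)" where
  "Pi_op X = vblock (hblock (Pi11 X) (Pi12 X)) (hblock (transpose (Pi12 X)) (Pi22 X))"

definition Lc :: "real^'n^'n \<Rightarrow> real^'m^'n" where
  "Lc X = L + Pi12 X"

definition Rc :: "real^'n^'n \<Rightarrow> real^'m^'m" where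
  "Rc X = R + Pi22 X"

definition Qc :: "real^'n^'n \<Rightarrow> real^'n^'n" where
  "Qc X = Q + Pi11 X"

definition Ac :: "real^'n^'n \<Rightarrow> real^'n^'n" where
  "Ac X = A - B ** matrix_inv (Rc X) ** transpose (Lc X)"

definition Gc :: "real^'n^'n \<Rightarrow> real^'n^'n" where
  "Gc X = B ** matrix_inv (Rc X) ** transpose B"

definition Hc :: "real^'n^'n \<Rightarrow> real^'n^'n" where
  "Hc X = Qc X - Lc X ** matrix_inv (Rc X) ** transpose (Lc X)"

definition riccati :: "real^'n^'n \<Rightarrow> real^'n^'n" where
  "riccati X = transpose (Ac X) ** X + X ** Ac X - X ** Gc X ** X + Hc X"

text \<open>Coefficients of the modified Newton iteration at the iterate \<open>Y\<close>
  (\<open>S\<^sub>Y\<close>, \<open>A\<^sub>Y\<close>, \<open>\<Pi>\<^sub>Y(X)\<close> and \<open>M\<^sub>Y\<close>).\<close>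

definition S_it :: "real^'n^'n \<Rightarrow> real^'m^'n" where
  "S_it Y = Y ** B + Lc Y"

definition A_it :: "real^'n^'n \<Rightarrow> real^'n^'n" where
  "A_it Y = A - B ** matrix_inv (Rc Y) ** transpose (S_it Y)"

definition Pi_it :: "real^'n^'n \<Rightarrow> real^'n^'n \<Rightarrow> real^'n^'n" where
  "Pi_it Y X =
    hblock (mat 1) (- (S_it Y ** matrix_inv (Rc Y))) ** Pi_op X **
    vblock (mat 1) (- (matrix_inv (Rc Y) ** transpose (S_it Y)))"

definition M_it :: "real^'n^'n \<Rightarrow> real^'n^'n" where
  "M_it Y =
    hblock (mat 1) (- (S_it Y ** matrix_inv (Rc Y))) **
    vblock (hblock Q L) (hblock (transpose L) R) **
    vblock (mat 1) (- (matrix_inv (Rc Y) ** transpose (S_it Y)))"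

definition newton_step :: "real^'n^'n \<Rightarrow> real^'n^'n \<Rightarrow> bool" where
  "newton_step Y X \<longleftrightarrow> transpose X = X \<and>
    transpose (A_it Y) ** X + X ** A_it Y = - Pi_it Y Y - M_it Y"

definition stabilizable :: bool where
  "stabilizable \<longleftrightarrow> (\<exists>F :: real^'n^'m. exponentially_stable (\<lambda>Z :: real^'n^'n.
    transpose (A + B ** F) ** Z + Z ** (A + B ** F) +
    (\<Sum>i=1..r. transpose (A0 i + B0 i ** F) ** Z ** (A0 i + B0 i ** F))))"

definition detectable :: "real^'n^'p \<Rightarrow> bool" where
  "detectable C \<longleftrightarrow> (\<exists>K :: real^'n^'p. exponentially_stable (\<lambda>Z :: real^'n^'n.
    transpose (transpose A + transpose C ** K) ** Z + Z ** (transpose A + transpose C ** K) +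
    (\<Sum>i=1..r. A0 i ** Z ** transpose (A0 i))))"

end

end

theory Submission
  imports Defs "HOL-Computational_Algebra.Fundamental_Theorem_Algebra"
begin

text \<open>Completing the square writes the Riccati form at \<open>x\<close> as the minimum over \<open>u\<close> of a Bellman form
  that is affine and (up to the drift term) monotone in \<open>X\<close>. Comparing Bellman forms at the control
  of the current iterate turns every claim of the induction into a Lyapunov inequality for
  \<open>A_it (X k)\<close>; stability of \<open>A_it (X k)\<close> is carried along in the induction. The decreasing iterates
  converge, the limit solves the equation by continuity, and its closed-loop matrix is a limit of
  stable matrices. Such a limit has no eigenvalue \<open>z\<close> with \<open>Re z > 0\<close>, because the characteristic
  polynomial of a stable \<open>n \<times> n\<close> matrix has modulus at least \<open>(Re z)\<^sup>n\<close> at \<open>z\<close>.\<close>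

section \<open>Powers of a matrix with spectral radius below one\<close>

text \<open>Once \<open>b k\<close> stays below \<open>d * (1 - \<rho>)\<close>, the number
  \<open>d\<close> is the fixed point of the dominating map t -> \<rho> t + d (1 - \<rho>), so the
  excess of \<open>a\<close> over \<open>d\<close> is bounded by a geometric sequence.\<close>

lemma affine_recurrence_tendsto_zero:
  fixes a b :: "nat \<Rightarrow> real"
  assumes rec: "\<And>k. a (Suc k) \<le> \<rho> * a k + b k" and nonneg: "\<And>k. 0 \<le> a k"
    and rho: "0 \<le> \<rho>" "\<rho> < 1" and b: "b \<longlonglongrightarrow> 0"
  shows "a \<longlonglongrightarrow> 0"
proof (rule LIMSEQ_I)
  fix e :: real assume "0 < e"
  define d where "d = e / 2"
  have "0 < d" using \<open>0 < e\<close> by (simp add: d_def)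
  then have "0 < d * (1 - \<rho>)" using rho by simp
  from LIMSEQ_D[OF b this] obtain N where N: "\<And>k. k \<ge> N \<Longrightarrow> \<bar>b k\<bar> < d * (1 - \<rho>)"
    by auto
  have step: "a (N + j) - d \<le> \<rho> ^ j * \<bar>a N\<bar>" for j
  proof (induction j)
    case 0
    then show ?case using \<open>0 < d\<close> by simp
  next
    case (Suc j)
    have "a (N + Suc j) \<le> \<rho> * a (N + j) + b (N + j)" using rec[of "N + j"] by simp
    also have "\<dots> \<le> \<rho> * a (N + j) + d * (1 - \<rho>)" using N[of "N + j"] by simp
    finally have "a (N + Suc j) - d \<le> \<rho> * (a (N + j) - d)" by (simp add: algebra_simps)
    also have "\<dots> \<le> \<rho> * (\<rho> ^ j * \<bar>a N\<bar>)" using Suc rho by (intro mult_left_mono) auto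
    finally show ?case by (simp add: mult.assoc)
  qed
  have "(\<lambda>j. \<rho> ^ j * \<bar>a N\<bar>) \<longlonglongrightarrow> 0"
    using tendsto_mult_right[OF LIMSEQ_power_zero, of \<rho> "\<bar>a N\<bar>"] rho by simp
  from LIMSEQ_D[OF this \<open>0 < d\<close>] obtain J where J: "\<And>j. j \<ge> J \<Longrightarrow> \<rho> ^ j * \<bar>a N\<bar> < d"
    by fastforce
  have "norm (a k - 0) < e" if "k \<ge> N + J" for k
  proof -
    have "J \<le> k - N" "N + (k - N) = k" using that by auto
    then show ?thesis
      using step[of "k - N"] J[of "k - N"] nonneg[of k] by (simp add: d_def)
  qed
  then show "\<exists>no. \<forall>k\<ge>no. norm (a k - 0) < e" by blast
qed

lemma tendsto_matrix_vector_mult: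
  fixes f :: "'b \<Rightarrow> 'a::real_normed_algebra_1^'n^'m"
  assumes "(f \<longlongrightarrow> M) F" "(g \<longlongrightarrow> x) F"
  shows "((\<lambda>k. f k *v g k) \<longlongrightarrow> M *v x) F"
  unfolding matrix_vector_mult_def
  by (intro tendsto_vec_lambda tendsto_sum tendsto_mult tendsto_vec_nth assms)

lemma norm_scalar_mult: "norm (c *s v) = cmod c * norm (v :: complex^'n)"
  by (simp add: norm_vec_def vector_scalar_mult_def norm_mult L2_set_right_distrib)

lemma mat_mult_vector: "mat c *v v = c *s (v :: 'a::semiring_1^'n)"
  by (simp add: vec_eq_iff mat_def matrix_vector_mult_def if_distrib[of "\<lambda>c. c * _"] cong: if_cong)

text \<open>The vector \<open>p(M) x\<close>.\<close>

definition poly_mat_apply :: "complex poly \<Rightarrow> complex^'n^'n \<Rightarrow> complex^'n \<Rightarrow> complex^'n" where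
  "poly_mat_apply p M x = fold_coeffs (\<lambda>a y. a *s x + M *v y) p 0"

lemma poly_mat_apply_0 [simp]: "poly_mat_apply 0 M x = 0"
  by (simp add: poly_mat_apply_def)

lemma poly_mat_apply_pCons [simp]:
  "poly_mat_apply (pCons a p) M x = a *s x + M *v poly_mat_apply p M x"
  by (cases "p = 0 \<and> a = 0") (auto simp: poly_mat_apply_def)

lemma poly_mat_apply_1 [simp]: "poly_mat_apply 1 M x = x"
  by (simp add: one_pCons)

lemma poly_mat_apply_add:
  "poly_mat_apply (p + q) M x = poly_mat_apply p M x + poly_mat_apply q M x"
  by (induction p q rule: poly_induct2) (simp_all add: algebra_simps vector_sadd_rdistrib matrix_vector_right_distrib)

lemma poly_mat_apply_sum:
  "poly_mat_apply (sum f I) M x = (\<Sum>i\<in>I. poly_mat_apply (f i) M x)"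
  by (induction I rule: infinite_finite_induct) (simp_all add: poly_mat_apply_add)

lemma poly_mat_apply_smult: "poly_mat_apply (smult c p) M x = c *s poly_mat_apply p M x"
  by (induction p) (simp_all add: vector_add_ldistrib vector_scalar_commute vector_smult_assoc)

text \<open>Since p(M) commutes with M, the linear factor may act on \<open>x\<close> first. In this
  form an induction over the roots can strip one factor by changing the vector.\<close>

lemma poly_mat_apply_linear_factor:
  "poly_mat_apply ([:- \<mu>, 1:] * p) M x = poly_mat_apply p M (M *v x - \<mu> *s x)"
proof -
  have "poly_mat_apply p M (M *v x - \<mu> *s x) =
      M *v poly_mat_apply p M x - \<mu> *s poly_mat_apply p M x"
  proof (induction p)
    case (pCons a p)
    show ?case
      by (simp add: pCons.IH vector_scalar_commute vector_smult_assoc vector_add_ldistrib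
          vector_ssub_ldistrib matrix_vector_right_distrib matrix_vector_mult_diff_distrib
          mult.commute)
  qed simp
  moreover have "[:- \<mu>, 1:] * p = smult (- \<mu>) p + pCons 0 p" by simp
  ultimately show ?thesis
    by (simp only: poly_mat_apply_add poly_mat_apply_smult poly_mat_apply_pCons) simp
qed

lemma poly_mat_apply_monom:
  "poly_mat_apply (monom c k) M x = c *s (((*v) M ^^ k) x)"
  by (induction k) (simp_all add: monom_Suc monom_0 vector_scalar_commute)

text \<open>The powers M^k x with k up to the real dimension of the space are one too many to be
  independent, and a dependence gives the coefficients of \<open>p\<close>. Dependence is a property
  of the set of powers, so a repeated power is treated separately, by the polynomial t^i -
  t^j.\<close>

lemma annihilating_poly_exists:
  fixes M :: "complex^'n^'n"
  obtains p where "p \<noteq> 0" "poly_mat_apply p M x = 0"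
proof -
  define f where "f k = ((*v) M ^^ k) x" for k
  define N where "N = DIM(complex^'n)"
  show ?thesis
  proof (cases "inj_on f {..N}")
    case True
    then have "card (f ` {..N}) > DIM(complex^'n)"
      by (simp add: card_image N_def)
    then have "dependent (f ` {..N})" by (rule dependent_biggerset)
    then obtain u w where u: "(\<Sum>v\<in>f ` {..N}. u v *\<^sub>R v) = 0" "w \<in> f ` {..N}" "u w \<noteq> 0"
      using dependent_finite[of "f ` {..N}"] by auto
    then obtain k where k: "k \<le> N" "u (f k) \<noteq> 0" by auto
    define p where "p = (\<Sum>i\<le>N. monom (complex_of_real (u (f i))) i)"
    have "coeff p k = of_real (u (f k))"
      using k by (simp add: p_def coeff_sum sum.delta)
    then have "p \<noteq> 0" using k by auto
    moreover have "poly_mat_apply p M x = (\<Sum>i\<le>N. u (f i) *\<^sub>R f i)"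
      unfolding p_def poly_mat_apply_sum poly_mat_apply_monom f_def[symmetric]
      by (intro sum.cong refl) (simp add: vec_eq_iff, simp add: scaleR_conv_of_real)
    moreover have "\<dots> = 0"
      using u(1) True by (simp add: sum.reindex)
    ultimately show ?thesis using that by simp
  next
    case False
    then obtain i j where ij: "i \<noteq> j" "f i = f j" by (auto simp: inj_on_def)
    define p where "p = monom (1::complex) i + monom (- 1) j"
    have "coeff p i = 1" using ij by (simp add: p_def)
    then have "p \<noteq> 0" by auto
    moreover have "poly_mat_apply p M x = 0"
      using ij by (simp add: p_def poly_mat_apply_add poly_mat_apply_monom f_def)
    ultimately show ?thesis using that by blast
  qed
qed

text \<open>Induction over the roots stands in for the Jordan form. Removing the root \<mu> replaces
  \<open>x\<close> by y = M x - \<mu> x, whose powers decay by induction; it remains to recover the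
  powers of \<open>x\<close> from those of \<open>y\<close>.\<close>

lemma annihilated_powers_tendsto_zero:
  fixes M :: "complex^'n^'n"
  assumes spec: "\<And>\<mu> v. M *v v = \<mu> *s v \<Longrightarrow> v \<noteq> 0 \<Longrightarrow> cmod \<mu> < 1"
    and "poly_mat_apply (\<Prod>\<mu>\<in>#Z. [:- \<mu>, 1:]) M x = 0"
  shows "(\<lambda>k. ((*v) M ^^ k) x) \<longlonglongrightarrow> 0"
  using assms(2)
proof (induction Z arbitrary: x)
  case empty
  have "((*v) M ^^ k) 0 = 0" for k by (induction k) simp_all
  with empty show ?case by simp
next
  case (add \<mu> Z)
  define y where "y = M *v x - \<mu> *s x"
  have "poly_mat_apply (\<Prod>\<mu>\<in>#Z. [:- \<mu>, 1:]) M y = 0"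
    using add.prems unfolding y_def poly_mat_apply_linear_factor[symmetric] by simp
  then have y: "(\<lambda>k. ((*v) M ^^ k) y) \<longlonglongrightarrow> 0" by (rule add.IH)
  have comm: "((*v) M ^^ k) (M *v v) = M *v ((*v) M ^^ k) v" for k v
    by (simp add: funpow_swap1)
  have powy: "((*v) M ^^ k) y = ((*v) M ^^ Suc k) x - \<mu> *s ((*v) M ^^ k) x" for k
    unfolding y_def
    by (induction k)
      (simp_all add: matrix_vector_mult_diff_distrib vector_scalar_commute)
  show ?case
  proof (cases "cmod \<mu> < 1")
    case True
    have "(\<lambda>k. norm (((*v) M ^^ k) x)) \<longlonglongrightarrow> 0"
    proof (rule affine_recurrence_tendsto_zero[where \<rho> = "cmod \<mu>"])
      fix k
      \<comment> \<open>The powers of \<open>x\<close> follow a scalar contraction by \<mu>,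
        perturbed by the decaying powers of \<open>y\<close>.\<close>
      have "((*v) M ^^ Suc k) x = \<mu> *s ((*v) M ^^ k) x + ((*v) M ^^ k) y"
        using powy[of k] by simp
      then show "norm (((*v) M ^^ Suc k) x) \<le>
          cmod \<mu> * norm (((*v) M ^^ k) x) + norm (((*v) M ^^ k) y)"
        by (metis norm_scalar_mult norm_triangle_ineq)
    qed (use True y in \<open>auto simp: tendsto_norm_zero\<close>)
    then show ?thesis by (rule tendsto_norm_zero_cancel)
  next
    case False
    \<comment> \<open>The annihilating polynomial need not be minimal, so this root need not be an
      eigenvalue; by \<open>spec\<close> it is none. Hence M - \<mu> I is invertible, and its
      inverse, which commutes with M, carries the powers of \<open>y\<close> to those of
      \<open>x\<close>.\<close>
    define P where "P = M - mat \<mu>"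
    have P: "P *v v = M *v v - \<mu> *s v" for v
      by (simp add: P_def matrix_vector_mult_diff_rdistrib mat_mult_vector)
    have "\<forall>v. P *v v = 0 \<longrightarrow> v = 0"
      using spec[of _ \<mu>] False by (auto simp: P)
    then obtain W where W: "W ** P = mat 1" using matrix_left_invertible_ker by blast
    then have W': "P ** W = mat 1" by (simp add: matrix_left_right_inverse)
    have PM: "P *v (M *v v) = M *v (P *v v)" for v
      by (simp add: P matrix_vector_mult_diff_distrib vector_scalar_commute)
    have WM: "W *v (M *v v) = M *v (W *v v)" for v
      by (metis PM W W' matrix_vector_mul_assoc matrix_vector_mul_lid)
    have "((*v) M ^^ k) x = W *v ((*v) M ^^ k) y" for k
    proof (induction k)
      case 0
      have "W *v (P *v x) = x" by (simp add: matrix_vector_mul_assoc W)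
      then show ?case by (simp add: P y_def)
    next
      case (Suc k)
      then show ?case by (simp add: WM)
    qed
    moreover have "(\<lambda>k. W *v ((*v) M ^^ k) y) \<longlonglongrightarrow> W *v 0"
      by (intro tendsto_matrix_vector_mult tendsto_const y)
    ultimately show ?thesis by simp
  qed
qed

lemma powers_tendsto_zero:
  fixes M :: "complex^'n^'n"
  assumes "\<And>\<mu> v. M *v v = \<mu> *s v \<Longrightarrow> v \<noteq> 0 \<Longrightarrow> cmod \<mu> < 1"
  shows "(\<lambda>k. ((*v) M ^^ k) x) \<longlonglongrightarrow> 0"
proof -
  obtain p where p: "p \<noteq> 0" "poly_mat_apply p M x = 0"
    using annihilating_poly_exists by blast
  obtain Z where Z: "p = smult (lead_coeff p) (\<Prod>\<mu>\<in>#Z. [:- \<mu>, 1:])"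
    using alg_closed_imp_factorization[OF p(1)] by blast
  have "lead_coeff p *s poly_mat_apply (\<Prod>\<mu>\<in>#Z. [:- \<mu>, 1:]) M x = 0"
    using p(2) Z poly_mat_apply_smult by metis
  then have "poly_mat_apply (\<Prod>\<mu>\<in>#Z. [:- \<mu>, 1:]) M x = 0"
    using p(1) by (simp add: vec_eq_iff)
  with assms show ?thesis by (rule annihilated_powers_tendsto_zero)
qed

section \<open>The Lyapunov inequality and limits of stable matrices\<close>

lemma det_eq_0_iff_kernel:
  fixes M :: "'a::field^'n^'n"
  shows "det M = 0 \<longleftrightarrow> (\<exists>v. v \<noteq> 0 \<and> M *v v = 0)"
  using invertible_det_nz[of M] invertible_left_inverse[of M] matrix_left_invertible_ker[of M]
  by blast

lemma inner_transpose_mult: "x \<bullet> (transpose M *v y) = (M *v x) \<bullet> (y :: real^'m)"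
  for M :: "real^'n^'m"
  by (metis dot_lmul_matrix inner_commute transpose_matrix_vector)

section \<open>Complexification and a real description of the spectrum\<close>

abbreviation complex_mat :: "real^'n^'m \<Rightarrow> complex^'n^'m" where
  "complex_mat \<equiv> map_matrix complex_of_real"

lemma complex_mat_mult: "complex_mat (X ** Y) = complex_mat X ** complex_mat Y"
  by (simp add: vec_eq_iff map_matrix_def matrix_matrix_mult_def)

lemma complex_mat_add: "complex_mat (X + Y) = complex_mat X + complex_mat Y"
  by (simp add: vec_eq_iff map_matrix_def)

lemma complex_mat_diff: "complex_mat (X - Y) = complex_mat X - complex_mat Y"
  by (simp add: vec_eq_iff map_matrix_def)

lemma complex_mat_1: "complex_mat (mat 1) = mat 1"
  by (simp add: vec_eq_iff map_matrix_def mat_def)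

text \<open>The eigenvector is split as v = a + i b, so that its two parts can be inserted into real
  quadratic forms.\<close>

lemma in_spectrum_iff_real:
  fixes X :: "real^'n^'n"
  shows "z \<in> spectrum X \<longleftrightarrow> (\<exists>a b. (a \<noteq> 0 \<or> b \<noteq> 0) \<and>
    X *v a = Re z *\<^sub>R a - Im z *\<^sub>R b \<and> X *v b = Im z *\<^sub>R a + Re z *\<^sub>R b)"
proof
  assume "z \<in> spectrum X"
  then obtain v where v: "v \<noteq> 0" "complex_mat X *v v = z *s v"
    by (auto simp: spectrum_def)
  define a b where "a = (\<chi> i. Re (v $ i))" and "b = (\<chi> i. Im (v $ i))"
  have eq: "(\<Sum>j\<in>UNIV. of_real (X $ i $ j) * v $ j) = z * v $ i" for i
    using v(2) by (simp add: vec_eq_iff matrix_vector_mult_def map_matrix_def)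
  have "X *v a = Re z *\<^sub>R a - Im z *\<^sub>R b"
    using arg_cong[OF eq, of Re] by (simp add: vec_eq_iff a_def b_def matrix_vector_mult_def)
  moreover have "X *v b = Im z *\<^sub>R a + Re z *\<^sub>R b"
    using arg_cong[OF eq, of Im]
    by (simp add: vec_eq_iff a_def b_def matrix_vector_mult_def add.commute)
  moreover have "a \<noteq> 0 \<or> b \<noteq> 0"
    using v(1) by (auto simp: vec_eq_iff a_def b_def complex_eq_iff)
  ultimately show "\<exists>a b. (a \<noteq> 0 \<or> b \<noteq> 0) \<and>
    X *v a = Re z *\<^sub>R a - Im z *\<^sub>R b \<and> X *v b = Im z *\<^sub>R a + Re z *\<^sub>R b"
    by blast
next
  assume "\<exists>a b. (a \<noteq> 0 \<or> b \<noteq> 0) \<and>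
    X *v a = Re z *\<^sub>R a - Im z *\<^sub>R b \<and> X *v b = Im z *\<^sub>R a + Re z *\<^sub>R b"
  then obtain a b where ab: "a \<noteq> 0 \<or> b \<noteq> 0"
    "X *v a = Re z *\<^sub>R a - Im z *\<^sub>R b" "X *v b = Im z *\<^sub>R a + Re z *\<^sub>R b"
    by blast
  define v where "v = (\<chi> i. Complex (a $ i) (b $ i))"
  have "v \<noteq> 0" using ab(1) by (auto simp: v_def vec_eq_iff complex_eq_iff)
  moreover have "complex_mat X *v v = z *s v"
    using ab(2,3)
    by (simp add: vec_eq_iff v_def matrix_vector_mult_def map_matrix_def complex_eq_iff algebra_simps)
  ultimately show "z \<in> spectrum X" by (auto simp: spectrum_def)
qed

text \<open>The Cayley transform carries the open left half-plane to the open unit disc.\<close>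

lemma cayley_norm_less_1:
  assumes "\<mu> \<noteq> - 1" "Re ((\<mu> - 1) / (\<mu> + 1)) < 0"
  shows "cmod \<mu> < 1"
proof -
  have nz: "\<mu> + 1 \<noteq> 0" using assms(1) by (metis add_eq_0_iff add.commute)
  then have "(Re (\<mu> + 1))\<^sup>2 + (Im (\<mu> + 1))\<^sup>2 > 0"
    by (metis cmod_power2 zero_less_norm_iff zero_less_power)
  \<comment> \<open>The numerator is the real part of (\<mu> - 1) times the conjugate of \<mu> + 1,
    which is |\<mu>|^2 - 1.\<close>
  moreover have "Re ((\<mu> - 1) / (\<mu> + 1)) =
      ((cmod \<mu>)\<^sup>2 - 1) / ((Re (\<mu> + 1))\<^sup>2 + (Im (\<mu> + 1))\<^sup>2)"
    unfolding Re_divide cmod_power2 by (simp add: power2_eq_square algebra_simps)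
  ultimately have "(cmod \<mu>)\<^sup>2 < 1"
    using assms(2) by (simp add: divide_less_0_iff)
  then show ?thesis by (simp add: abs_square_less_1)
qed

text \<open>Along the iterates of the Cayley transform \<open>(I + A) (I - A)\<^sup>-\<^sup>1\<close>, which tend to \<open>0\<close>, the form of
  \<open>Y\<close> does not increase; this replaces the matrix exponential in the usual argument.\<close>

lemma lyapunov_possemidef:
  fixes A Y :: "real^'n^'n"
  assumes "stable A" and sym: "transpose Y = Y" and neg: "\<And>x. (A *v x) \<bullet> (Y *v x) \<le> 0"
  shows "possemidef Y"
proof -
  have spec: "Re z < 0" if "z \<in> spectrum A" for z
    using assms(1) that by (auto simp: stable_def)
  have "\<forall>x. (mat 1 - A) *v x = 0 \<longrightarrow> x = 0"
  proof (intro allI impI, rule ccontr)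
    fix x assume "(mat 1 - A) *v x = 0" "x \<noteq> 0"
    then have "1 \<in> spectrum A"
      unfolding in_spectrum_iff_real
      by (intro exI[of _ x] exI[of _ 0]) (simp add: matrix_vector_mult_diff_rdistrib)
    then show False using spec[of 1] by simp
  qed
  then obtain W where W: "W ** (mat 1 - A) = mat 1" using matrix_left_invertible_ker by blast
  then have W': "(mat 1 - A) ** W = mat 1" by (simp add: matrix_left_right_inverse)
  define C where "C = (mat 1 + A) ** W"
  \<comment> \<open>An eigenvector \<open>v\<close> of C with eigenvalue \<mu> gives the eigenvector
    y = W v of A with eigenvalue (\<mu> - 1) / (\<mu> + 1); the case \<mu> = -1 would force y =
    0.\<close>
  have spec_C: "cmod \<mu> < 1" if \<mu>: "complex_mat C *v v = \<mu> *s v" "v \<noteq> 0" for \<mu> v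
  proof -
    define y where "y = complex_mat W *v v"
    have "(mat 1 - complex_mat A) ** complex_mat W = mat 1"
      using arg_cong[OF W', of complex_mat]
      by (simp add: complex_mat_mult complex_mat_diff complex_mat_1)
    then have v: "y - complex_mat A *v y = v"
      unfolding y_def
      by (metis matrix_vector_mul_assoc matrix_vector_mul_lid matrix_vector_mult_diff_rdistrib)
    have "y + complex_mat A *v y = \<mu> *s v"
      using \<mu>(1) unfolding y_def C_def complex_mat_mult complex_mat_add complex_mat_1
      by (metis matrix_vector_mul_assoc matrix_vector_mul_lid matrix_vector_mult_add_rdistrib)
    then have eq: "y $ i + (complex_mat A *v y) $ i = \<mu> * (y $ i - (complex_mat A *v y) $ i)" for i
      unfolding v[symmetric] by (simp add: vec_eq_iff algebra_simps)
    have "y \<noteq> 0" using \<mu>(2) v by auto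
    have "\<mu> \<noteq> - 1"
    proof
      assume "\<mu> = - 1"
      then have "y $ i = 0" for i using eq[of i] by simp
      with \<open>y \<noteq> 0\<close> show False by (simp add: vec_eq_iff)
    qed
    then have nz: "\<mu> + 1 \<noteq> 0" by (metis add_eq_0_iff add.commute)
    have "(complex_mat A *v y) $ i = (\<mu> - 1) / (\<mu> + 1) * y $ i" for i
      using eq[of i] nz by (simp add: field_simps)
    then have "(\<mu> - 1) / (\<mu> + 1) \<in> spectrum A"
      using \<open>y \<noteq> 0\<close> unfolding spectrum_def by (auto simp: vec_eq_iff intro!: exI[of _ y])
    then show ?thesis using spec cayley_norm_less_1 \<open>\<mu> \<noteq> - 1\<close> by blast
  qed
  have decay: "(\<lambda>k. ((*v) C ^^ k) x) \<longlonglongrightarrow> 0" for x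
  proof -
    define c where "c y = (\<chi> i. complex_of_real (y $ i))" for y :: "real^'n"
    have "complex_mat C *v c y = c (C *v y)" for y
      by (simp add: c_def vec_eq_iff matrix_vector_mult_def map_matrix_def)
    then have pow: "((*v) (complex_mat C) ^^ k) (c x) = c (((*v) C ^^ k) x)" for k
      by (induction k) simp_all
    have "(\<lambda>k. c (((*v) C ^^ k) x)) \<longlonglongrightarrow> 0"
      using powers_tendsto_zero[of "complex_mat C" "c x", OF spec_C] by (simp add: pow)
    then have "(\<lambda>k. Re (c (((*v) C ^^ k) x) $ i)) \<longlonglongrightarrow> Re ((0 :: complex^'n) $ i)" for i
      by (intro tendsto_Re tendsto_vec_nth)
    then show ?thesis
      by (intro vec_tendstoI) (simp add: c_def)
  qed
  define q where "q x = x \<bullet> (Y *v x)" for x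
  have Ysym: "a \<bullet> (Y *v b) = b \<bullet> (Y *v a)" for a b
    using inner_transpose_mult[of a Y b] by (simp add: sym inner_commute)
  have q_C: "q (C *v x) \<le> q x" for x
  proof -
    define y where "y = W *v x"
    have x: "x = y - A *v y"
      unfolding y_def
      by (metis W' matrix_vector_mul_assoc matrix_vector_mul_lid matrix_vector_mult_diff_rdistrib)
    have Cx: "C *v x = y + A *v y"
      unfolding y_def C_def
      by (metis matrix_vector_mul_assoc matrix_vector_mul_lid matrix_vector_mult_add_rdistrib)
    \<comment> \<open>The two arguments are y + A y and y - A y, so the pure squares cancel and only
      the cross terms survive.\<close>
    have "q (C *v x) - q x = 4 * ((A *v y) \<bullet> (Y *v y))"
      unfolding q_def Cx unfolding x
      using Ysym[of y "A *v y"]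
      by (simp add: inner_simps matrix_vector_right_distrib matrix_vector_mult_diff_distrib)
    with neg[of y] show ?thesis by simp
  qed
  have "0 \<le> q x" for x
  proof (rule LIMSEQ_le_const2)
    show "(\<lambda>k. q (((*v) C ^^ k) x)) \<longlonglongrightarrow> 0"
      unfolding q_def using tendsto_inner[OF decay tendsto_matrix_vector_mult[OF tendsto_const decay]]
      by simp
    have "q (((*v) C ^^ k) x) \<le> q x" for k
      by (induction k) (auto intro: order_trans[OF q_C])
    then show "\<exists>N. \<forall>k\<ge>N. q (((*v) C ^^ k) x) \<le> q x" by blast
  qed
  then show ?thesis by (simp add: possemidef_def sym q_def)
qed

section \<open>The characteristic polynomial and the distance to the eigenvalues\<close>

definition matrix_char_poly :: "'a::comm_ring_1^'n^'n \<Rightarrow> 'a poly" where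
  "matrix_char_poly M = det (\<chi> i j. if i = j then [:- M $ i $ j, 1:] else [:- M $ i $ j:])"

lemma poly_matrix_char_poly: "poly (matrix_char_poly M) z = det (mat z - M)"
  unfolding matrix_char_poly_def det_def
  by (auto simp: poly_sum poly_prod mat_def
      intro!: sum.cong arg_cong2[where f = "(*)", OF refl prod.cong[OF refl]])

text \<open>In the Leibniz expansion off-diagonal entries are constants. A permutation other than
  the identity therefore gives degree below n, while the identity gives a product of n monic linear
  factors.\<close>

lemma matrix_char_poly_monic:
  fixes M :: "'a::idom^'n^'n"
  shows "degree (matrix_char_poly M) = CARD('n)" and "lead_coeff (matrix_char_poly M) = 1"
proof -
  define e where "e i j = (if i = j then [:- M $ i $ j, 1:] else [:- M $ i $ j:])" for i j
  define f where "f p = of_int (sign p) * (\<Prod>i\<in>UNIV. e i (p i))" for p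
  have char: "matrix_char_poly M = (\<Sum>p | p permutes UNIV. f p)"
    by (simp add: matrix_char_poly_def det_def f_def e_def)
  have deg_e: "degree (e i j) \<le> (if i = j then 1 else 0)" for i j
    by (simp add: e_def)
  have deg_f: "degree (f p) \<le> (\<Sum>i\<in>UNIV. degree (e i (p i)))" for p
  proof -
    have "degree (f p) \<le> degree (of_int (sign p) :: 'a poly) + degree (\<Prod>i\<in>UNIV. e i (p i))"
      unfolding f_def by (rule degree_mult_le)
    also have "degree (of_int (sign p) :: 'a poly) = 0" by (simp add: degree_of_int)
    also have "degree (\<Prod>i\<in>UNIV. e i (p i)) \<le> (\<Sum>i\<in>UNIV. degree (e i (p i)))"
      using degree_prod_sum_le[of UNIV "\<lambda>i. e i (p i)"] by (simp add: o_def)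
    finally show ?thesis by simp
  qed
  have le: "degree (f p) \<le> CARD('n)" for p
  proof -
    have "(\<Sum>i\<in>UNIV. degree (e i (p i))) \<le> (\<Sum>i\<in>(UNIV::'n set). 1)"
      by (intro sum_mono) (simp add: e_def)
    with deg_f[of p] show ?thesis by simp
  qed
  have off: "coeff (f p) CARD('n) = 0" if "p \<noteq> id" for p
  proof -
    obtain i where i: "p i \<noteq> i" using \<open>p \<noteq> id\<close> by (auto simp: fun_eq_iff)
    have "(\<Sum>i\<in>UNIV. degree (e i (p i))) < (\<Sum>i\<in>(UNIV::'n set). 1)"
      by (rule sum_strict_mono_ex1) (use i in \<open>auto simp: e_def intro!: exI[of _ i]\<close>)
    with deg_f[of p] show ?thesis by (intro coeff_eq_0) simp
  qed
  have "degree (\<Prod>i\<in>(UNIV::'n set). e i i) = CARD('n)"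
    by (subst degree_prod_eq_sum_degree) (auto simp: e_def)
  moreover have "lead_coeff (\<Prod>i\<in>(UNIV::'n set). e i i) = 1"
    by (simp add: lead_coeff_prod e_def)
  ultimately have diag: "coeff (f id) CARD('n) = 1"
    by (simp add: f_def sign_id)
  have "coeff (matrix_char_poly M) CARD('n) = (\<Sum>p | p permutes (UNIV::'n set). if p = id then 1 else 0)"
    unfolding char coeff_sum by (intro sum.cong) (auto simp: off diag)
  also have "\<dots> = 1" by (subst sum.delta) (auto simp: permutes_id)
  finally have top: "coeff (matrix_char_poly M) CARD('n) = 1" .
  have "degree (matrix_char_poly M) \<le> CARD('n)"
    unfolding char by (intro degree_sum_le) (auto simp: le)
  with top show deg: "degree (matrix_char_poly M) = CARD('n)"
    by (metis le_antisym le_degree zero_neq_one)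
  with top show "lead_coeff (matrix_char_poly M) = 1" by simp
qed

text \<open>The determinant is the product of z - \<mu> over the n roots \<mu> of the characteristic
  polynomial, and each root is an eigenvalue, so every factor has modulus at least \<delta>.\<close>

lemma norm_det_ge_dist_eigenvalues:
  fixes M :: "complex^'n^'n"
  assumes eig: "\<And>\<mu> v. M *v v = \<mu> *s v \<Longrightarrow> v \<noteq> 0 \<Longrightarrow> \<delta> \<le> cmod (z - \<mu>)" and "0 \<le> \<delta>"
  shows "\<delta> ^ CARD('n) \<le> cmod (det (mat z - M))"
proof -
  let ?p = "matrix_char_poly M"
  have "?p \<noteq> 0" using matrix_char_poly_monic(2)[of M] by auto
  then obtain Z where Z: "size Z = CARD('n)" "?p = (\<Prod>\<mu>\<in>#Z. [:- \<mu>, 1:])"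
    using alg_closed_imp_factorization[of ?p] matrix_char_poly_monic[of M] by auto
  have poly_Z: "poly (\<Prod>\<mu>\<in>#Z'. [:- \<mu>, 1:]) w = (\<Prod>\<mu>\<in>#Z'. w - \<mu>)" for Z' and w :: complex
    by (induction Z') (simp_all add: algebra_simps)
  have dist: "\<delta> \<le> cmod (z - \<mu>)" if "\<mu> \<in># Z" for \<mu>
  proof -
    have "det (mat \<mu> - M) = 0"
      using that unfolding poly_matrix_char_poly[symmetric] Z(2) poly_Z
      by (auto simp: prod_mset_zero_iff)
    then obtain v where "v \<noteq> 0" "(mat \<mu> - M) *v v = 0"
      using det_eq_0_iff_kernel by blast
    then show ?thesis
      using eig[of v \<mu>] by (simp add: matrix_vector_mult_diff_rdistrib mat_mult_vector)
  qed
  \<comment> \<open>Stated for all multisets with elements in \<open>Z\<close>, so that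
    \<open>dist\<close> stays applicable throughout the induction.\<close>
  have "\<delta> ^ size Z' \<le> cmod (\<Prod>\<mu>\<in>#Z'. z - \<mu>)" if "set_mset Z' \<subseteq> set_mset Z" for Z'
    using that
  proof (induction Z')
    case (add \<mu> Z')
    then show ?case
      using add.IH dist \<open>0 \<le> \<delta>\<close> by (auto simp: norm_mult intro!: mult_mono)
  qed simp
  from this[of Z] show ?thesis
    by (simp add: Z poly_matrix_char_poly[symmetric] poly_Z)
qed

lemma tendsto_det:
  fixes f :: "'b \<Rightarrow> 'a::real_normed_field^'n^'n"
  assumes "(f \<longlongrightarrow> M) F"
  shows "((\<lambda>k. det (f k)) \<longlongrightarrow> det M) F"
  unfolding det_def
  by (intro tendsto_sum tendsto_mult tendsto_const tendsto_prod tendsto_vec_nth assms)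

lemma spectrum_limit_of_stable:
  fixes A :: "real^'n^'n"
  assumes lim: "X \<longlonglongrightarrow> A" and stab: "\<And>k. stable (X k)" and z: "z \<in> spectrum A"
  shows "Re z \<le> 0"
proof (rule ccontr)
  assume "\<not> Re z \<le> 0"
  then have pos: "0 < Re z" by simp
  have "Re z ^ CARD('n) \<le> cmod (det (mat z - complex_mat (X k)))" for k
  proof (rule norm_det_ge_dist_eigenvalues)
    fix \<mu> v assume "complex_mat (X k) *v v = \<mu> *s v" "v \<noteq> 0"
    then have "\<mu> \<in> spectrum (X k)" by (auto simp: spectrum_def)
    then have "Re \<mu> < 0" using stab[of k] by (auto simp: stable_def)
    \<comment> \<open>The bound does not depend on \<open>k\<close>, which is why it survives the
      limit.\<close>
    then have "Re z \<le> Re (z - \<mu>)" by simp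
    also have "\<dots> \<le> cmod (z - \<mu>)" by (rule complex_Re_le_cmod)
    finally show "Re z \<le> cmod (z - \<mu>)" .
  qed (use pos in simp)
  moreover have "(\<lambda>k. complex_mat (X k)) \<longlonglongrightarrow> complex_mat A"
    unfolding map_matrix_def
    by (auto intro!: tendsto_vec_lambda tendsto_of_real tendsto_vec_nth lim)
  then have "(\<lambda>k. cmod (det (mat z - complex_mat (X k)))) \<longlonglongrightarrow> cmod (det (mat z - complex_mat A))"
    by (intro tendsto_norm tendsto_det tendsto_diff tendsto_const)
  ultimately have "Re z ^ CARD('n) \<le> cmod (det (mat z - complex_mat A))"
    by (meson LIMSEQ_le_const)
  with zero_less_power[OF pos, of "CARD('n)"] have "det (mat z - complex_mat A) \<noteq> 0"
    by (metis norm_zero not_le)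
  moreover obtain v where "v \<noteq> 0" "complex_mat A *v v = z *s v"
    using z by (auto simp: spectrum_def)
  then have "det (mat z - complex_mat A) = 0"
    unfolding det_eq_0_iff_kernel
    by (auto simp: matrix_vector_mult_diff_rdistrib mat_mult_vector)
  ultimately show False by simp
qed

section \<open>Quadratic forms and convergence of matrices\<close>

lemma transpose_add: "transpose (X + Y) = transpose X + transpose (Y :: real^'n^'m)"
  by (simp add: vec_eq_iff transpose_def)

lemma transpose_diff: "transpose (X - Y) = transpose X - transpose (Y :: real^'n^'m)"
  by (simp add: vec_eq_iff transpose_def)

lemma transpose_minus: "transpose (- X) = - transpose (X :: real^'n^'m)"
  by (simp add: vec_eq_iff transpose_def)

lemma transpose_sum: "transpose (\<Sum>i\<in>I. f i) = (\<Sum>i\<in>I. transpose (f i :: real^'n^'m))"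
  by (simp add: vec_eq_iff transpose_def)

lemma matrix_vector_mult_minus_left: "(- X) *v y = - (X *v (y :: real^'n))"
  by (simp add: vec_eq_iff matrix_vector_mult_def sum_negf)

lemma matrix_vector_mult_sum_left: "(\<Sum>i\<in>I. f i) *v y = (\<Sum>i\<in>I. f i *v (y :: real^'n))"
  by (induction I rule: infinite_finite_induct) (simp_all add: matrix_vector_mult_add_rdistrib)

lemmas matrix_vector_distribs =
  matrix_vector_mult_add_rdistrib matrix_vector_mult_diff_rdistrib matrix_vector_mult_minus_left
  matrix_vector_right_distrib matrix_vector_mult_diff_distrib matrix_vector_mul_assoc[symmetric]

lemma inner_symmetric_swap:
  fixes S :: "real^'n^'n"
  assumes "transpose S = S"
  shows "x \<bullet> (S *v y) = y \<bullet> (S *v x)"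
  using inner_transpose_mult[of x S y] by (simp add: assms inner_commute)

lemma hblock_mult_vblock: "hblock X Y ** vblock Z W = X ** Z + Y ** (W :: real^'k^'m)"
  by (simp add: vec_eq_iff matrix_matrix_mult_def hblock_def vblock_def UNIV_Plus_UNIV[symmetric]
      sum.Plus del: UNIV_Plus_UNIV)

lemma hblock_mult_block:
  "hblock X Y ** vblock (hblock P S) (hblock T U) =
    hblock (X ** P + Y ** T) (X ** S + Y ** (U :: real^'k^'m))"
  by (simp add: vec_eq_iff matrix_matrix_mult_def hblock_def vblock_def UNIV_Plus_UNIV[symmetric]
      sum.Plus sum.distrib split: sum.split del: UNIV_Plus_UNIV)

text \<open>The outer factors insert the pair (x, -K x) into the block form. With K the gain of the
  iterate this evaluates both \<open>Pi_it\<close> and \<open>M_it\<close>.\<close>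

lemma block_quadratic_form:
  fixes P :: "real^'n^'n" and S :: "real^'m^'n" and T :: "real^'m^'m" and K :: "real^'n^'m"
  shows "x \<bullet> ((hblock (mat 1) (- transpose K) ** vblock (hblock P S) (hblock (transpose S) T) **
      vblock (mat 1) (- K)) *v x) =
    x \<bullet> (P *v x) - 2 * (x \<bullet> (S *v (K *v x))) + (K *v x) \<bullet> (T *v (K *v x))"
proof -
  have "x \<bullet> (transpose K *v (transpose S *v x)) = x \<bullet> (S *v (K *v x))"
    by (simp only: inner_transpose_mult) (simp add: inner_commute)
  then show ?thesis
    unfolding hblock_mult_block unfolding hblock_mult_vblock
    by (simp add: matrix_vector_distribs inner_simps inner_transpose_mult vec.neg
        del: transpose_matrix_vector)
qed

lemma posdef_invertible: "posdef M \<Longrightarrow> invertible M"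
  unfolding invertible_left_inverse matrix_left_invertible_ker posdef_def
  by (metis inner_zero_right less_irrefl)

lemma matrix_inv_both:
  assumes "invertible (M :: 'a::semiring_1^'n^'m)"
  shows matrix_inv_right: "M ** matrix_inv M = mat 1"
    and matrix_inv_left: "matrix_inv M ** M = mat 1"
  using someI_ex[OF assms[unfolded invertible_def]] unfolding matrix_inv_def by auto

lemma posdef_matrix_inv_symmetric:
  assumes "posdef M"
  shows "transpose (matrix_inv M) = matrix_inv M"
proof -
  note inv = matrix_inv_both[OF posdef_invertible[OF assms]]
  have "transpose (matrix_inv M) ** M = mat 1"
    using arg_cong[OF inv(1), of transpose] assms by (simp add: matrix_transpose_mul posdef_def)
  then show ?thesis by (metis inv(1) matrix_mul_assoc matrix_mul_lid matrix_mul_rid)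
qed

lemma possemidef_add_posdef: "posdef X \<Longrightarrow> possemidef Y \<Longrightarrow> posdef (X + Y)"
  unfolding posdef_def possemidef_def
  by (simp add: transpose_add matrix_vector_distribs inner_simps add_pos_nonneg)

text \<open>Polarisation: a symmetric bilinear form is determined by its diagonal.\<close>

lemma symmetric_form_eq_0:
  fixes S :: "real^'n^'n"
  assumes "transpose S = S" and zero: "\<And>x. x \<bullet> (S *v x) = 0"
  shows "S = 0"
proof -
  have "x \<bullet> (S *v y) = 0" for x y
    using zero[of "x + y"] zero[of x] zero[of y] inner_symmetric_swap[OF assms(1), of x y]
    by (simp add: matrix_vector_distribs inner_simps)
  then have "S *v y = 0" for y by (metis inner_eq_zero_iff)
  then show ?thesis by (simp add: matrix_eq)
qed

lemma matrix_nth_eq_inner: "S $ i $ j = axis i 1 \<bullet> (S *v axis j (1 :: real))"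
  by (simp add: inner_axis' matrix_vector_mult_basis column_def)

text \<open>Each scalar sequence x \<bullet> X_k x is decreasing and bounded below by 0, hence
  convergent; polarisation on the basis vectors recovers the entries.\<close>

lemma possemidef_decreasing_convergent:
  fixes X :: "nat \<Rightarrow> real^'n^'n"
  assumes psd: "\<And>k. possemidef (X k)" and dec: "\<And>k. possemidef (X k - X (Suc k))"
  obtains Y where "X \<longlonglongrightarrow> Y"
proof -
  define q where "q k x = x \<bullet> (X k *v x)" for k x
  have "convergent (\<lambda>k. q k x)" for x
  proof (rule Bseq_monoseq_convergent)
    have nonneg: "0 \<le> q k x" for k using psd[of k] by (simp add: q_def possemidef_def)
    have anti: "q (Suc k) x \<le> q k x" for k
      using dec[of k] by (simp add: q_def possemidef_def matrix_vector_distribs inner_simps)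
    then have "decseq (\<lambda>k. q k x)" by (rule decseq_SucI)
    then show "monoseq (\<lambda>k. q k x)" by (rule decseq_imp_monoseq)
    show "Bseq (\<lambda>k. q k x)"
      by (rule BseqI'[of _ "q 0 x"]) (use nonneg \<open>decseq _\<close> in \<open>simp add: decseq_def\<close>)
  qed
  then obtain l where l: "\<And>x. (\<lambda>k. q k x) \<longlonglongrightarrow> l x" unfolding convergent_def by metis
  define Y where "Y = (\<chi> i j. (l (axis i 1 + axis j 1) - l (axis i 1) - l (axis j 1)) / 2)"
  have nth: "X k $ i $ j = (q k (axis i 1 + axis j 1) - q k (axis i 1) - q k (axis j 1)) / 2" for k i j
    using inner_symmetric_swap[of "X k" "axis i 1" "axis j 1"] psd[of k]
    unfolding possemidef_def matrix_nth_eq_inner[of "X k"]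
    by (simp add: q_def matrix_vector_distribs inner_simps)
  have "X \<longlonglongrightarrow> Y"
    unfolding Y_def
    by (intro vec_tendstoI, simp only: nth vec_lambda_beta) (intro tendsto_intros l, simp)
  then show ?thesis by (rule that)
qed

section \<open>Continuity of the matrix operations\<close>

lemma tendsto_transpose:
  fixes f :: "'b \<Rightarrow> real^'n^'m"
  assumes "(f \<longlongrightarrow> M) F"
  shows "((\<lambda>k. transpose (f k)) \<longlongrightarrow> transpose M) F"
  unfolding transpose_def by (intro tendsto_vec_lambda tendsto_vec_nth assms)

lemma tendsto_matrix_mult:
  fixes f :: "'b \<Rightarrow> 'a::real_normed_algebra_1^'n^'m"
  assumes "(f \<longlongrightarrow> M) F" "(g \<longlongrightarrow> N) F"
  shows "((\<lambda>k. f k ** g k) \<longlongrightarrow> M ** N) F"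
  unfolding matrix_matrix_mult_def
  by (intro tendsto_vec_lambda tendsto_sum tendsto_mult tendsto_vec_nth assms)

text \<open>Cramer's rule writes each entry of the inverse as a quotient of determinants, and
  determinants are continuous.\<close>

lemma tendsto_matrix_inv:
  fixes f :: "'b \<Rightarrow> real^'n^'n"
  assumes lim: "(f \<longlongrightarrow> M) F" and inv: "\<And>k. invertible (f k)" "invertible M"
  shows "((\<lambda>k. matrix_inv (f k)) \<longlongrightarrow> matrix_inv M) F"
proof -
  have cramer: "matrix_inv N $ i $ j =
      det (\<chi> a b. if b = i then axis j 1 $ a else N $ a $ b) / det N"
    if "invertible N" for N :: "real^'n^'n" and i j
  proof -
    have "N *v (matrix_inv N *v axis j 1) = axis j 1"
      using that by (simp add: matrix_vector_mul_assoc matrix_inv_right)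
    then have "matrix_inv N *v axis j 1 =
        (\<chi> k. det (\<chi> a b. if b = k then axis j 1 $ a else N $ a $ b) / det N)"
      using that cramer[of N] invertible_det_nz by blast
    then show ?thesis
      by (simp add: matrix_vector_mult_basis column_def vec_eq_iff)
  qed
  have "((\<lambda>k. \<chi> a b. if b = i then axis j (1::real) $ a else f k $ a $ b) \<longlongrightarrow>
      (\<chi> a b. if b = i then axis j 1 $ a else M $ a $ b)) F" for i j
    by (intro tendsto_vec_lambda) (auto intro!: tendsto_vec_nth lim)
  then show ?thesis
    using inv by (intro vec_tendstoI)
      (auto simp: cramer invertible_det_nz intro!: tendsto_divide tendsto_det lim)
qed

lemma possemidef_limit:
  fixes X :: "nat \<Rightarrow> real^'n^'n"
  assumes lim: "X \<longlonglongrightarrow> Y" and psd: "\<And>k. possemidef (X k)"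
  shows "possemidef Y"
proof -
  have "transpose Y = Y"
    using LIMSEQ_unique[OF tendsto_transpose[OF lim]] lim psd by (simp add: possemidef_def)
  moreover have "0 \<le> x \<bullet> (Y *v x)" for x
  proof (rule LIMSEQ_le_const)
    show "(\<lambda>k. x \<bullet> (X k *v x)) \<longlonglongrightarrow> x \<bullet> (Y *v x)"
      by (intro tendsto_inner tendsto_matrix_vector_mult tendsto_const lim)
  qed (use psd in \<open>auto simp: possemidef_def\<close>)
  ultimately show ?thesis by (simp add: possemidef_def)
qed

text \<open>For the eigenvector a + i b with eigenvalue \<alpha> + i \<beta>, the terms in \<beta>
  cancel by the symmetry of \<open>W\<close>; the result is the real part of a Hermitian
  form.\<close>

lemma eigenpair_form:
  fixes M W :: "real^'n^'n"
  assumes "transpose W = W"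
    and "M *v a = \<alpha> *\<^sub>R a - \<beta> *\<^sub>R b" "M *v b = \<beta> *\<^sub>R a + \<alpha> *\<^sub>R b"
  shows "(M *v a) \<bullet> (W *v a) + (M *v b) \<bullet> (W *v b) = \<alpha> * (a \<bullet> (W *v a) + b \<bullet> (W *v b))"
  unfolding assms(2,3) using inner_symmetric_swap[OF assms(1), of a b]
  by (simp add: inner_simps algebra_simps)

section \<open>The modified Newton iteration\<close>

context scare
begin

text \<open>The feedback matrix of the iterate, signed so that \<open>A_it Y\<close> is
  \<open>A - B ** gain Y\<close>.\<close>

definition gain :: "real^'n^'n \<Rightarrow> real^'n^'m" where
  "gain Y = matrix_inv (Rc Y) ** transpose (S_it Y)"

text \<open>The derivative of the value \<open>x \<bullet> X x\<close> plus the running cost, at state \<open>x\<close> under the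
  control \<open>- u\<close>; \<open>noise_form\<close> is the contribution of the stochastic terms.\<close>

definition noise_form :: "real^'n^'n \<Rightarrow> real^'n \<Rightarrow> real^'m \<Rightarrow> real" where
  "noise_form X x u = (\<Sum>i=1..r. (A0 i *v x - B0 i *v u) \<bullet> (X *v (A0 i *v x - B0 i *v u)))"

definition bellman_form :: "real^'n^'n \<Rightarrow> real^'n \<Rightarrow> real^'m \<Rightarrow> real" where
  "bellman_form X x u = 2 * ((A *v x - B *v u) \<bullet> (X *v x)) + noise_form X x u +
    x \<bullet> (Q *v x) - 2 * (x \<bullet> (L *v u)) + u \<bullet> (R *v u)"

lemma noise_form_nonneg: "possemidef X \<Longrightarrow> 0 \<le> noise_form X x u"
  by (auto simp: noise_form_def possemidef_def intro!: sum_nonneg)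

text \<open>The cost terms do not involve the matrix argument and cancel; the rest is linear in
  it.\<close>

lemma bellman_form_diff:
  "bellman_form X x u - bellman_form Y x u =
    2 * ((A *v x - B *v u) \<bullet> ((X - Y) *v x)) + noise_form (X - Y) x u"
  by (simp add: bellman_form_def noise_form_def matrix_vector_distribs inner_diff_right
      sum_subtractf)

lemma Pi_symmetric:
  assumes "transpose X = X"
  shows "transpose (Pi11 X) = Pi11 X" "transpose (Pi22 X) = Pi22 X"
  by (simp_all add: Pi11_def Pi22_def transpose_sum matrix_transpose_mul assms matrix_mul_assoc)

lemma Pi_inner:
  shows "x \<bullet> (Pi11 X *v y) = (\<Sum>i=1..r. (A0 i *v x) \<bullet> (X *v (A0 i *v y)))"
    and "x \<bullet> (Pi12 X *v u) = (\<Sum>i=1..r. (A0 i *v x) \<bullet> (X *v (B0 i *v u)))"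
    and "v \<bullet> (Pi22 X *v u) = (\<Sum>i=1..r. (B0 i *v v) \<bullet> (X *v (B0 i *v u)))"
  by (simp_all add: Pi11_def Pi12_def Pi22_def matrix_vector_mult_sum_left inner_sum_right
      matrix_vector_mul_assoc[symmetric] inner_transpose_mult del: transpose_matrix_vector)

lemma noise_form_Pi:
  assumes "transpose X = X"
  shows "noise_form X x u = x \<bullet> (Pi11 X *v x) - 2 * (x \<bullet> (Pi12 X *v u)) + u \<bullet> (Pi22 X *v u)"
proof -
  have "(A0 i *v x - B0 i *v u) \<bullet> (X *v (A0 i *v x - B0 i *v u)) =
      (A0 i *v x) \<bullet> (X *v (A0 i *v x)) - 2 * ((A0 i *v x) \<bullet> (X *v (B0 i *v u))) +
      (B0 i *v u) \<bullet> (X *v (B0 i *v u))" for i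
    using inner_symmetric_swap[OF assms, of "A0 i *v x" "B0 i *v u"]
    by (simp add: matrix_vector_mult_diff_distrib inner_simps)
  then show ?thesis
    by (simp add: noise_form_def Pi_inner sum.distrib sum_subtractf sum_distrib_left)
qed

text \<open>Sorted by degree in \<open>u\<close>, ready for completing the square: the linear terms
  from B, L and \<open>Pi12\<close> combine into \<open>S_it\<close>, the quadratic ones into
  \<open>Rc\<close>.\<close>

lemma bellman_form_expand:
  assumes "transpose X = X"
  shows "bellman_form X x u = 2 * ((A *v x) \<bullet> (X *v x)) + x \<bullet> (Qc X *v x) -
    2 * (u \<bullet> (transpose (S_it X) *v x)) + u \<bullet> (Rc X *v u)"
proof -
  have "u \<bullet> (transpose (S_it X) *v x) =
      (B *v u) \<bullet> (X *v x) + x \<bullet> (L *v u) + x \<bullet> (Pi12 X *v u)"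
    unfolding inner_transpose_mult S_it_def Lc_def
    using inner_symmetric_swap[OF assms, of x "B *v u"]
    by (simp add: matrix_vector_distribs inner_add_right inner_commute[of _ x])
  then show ?thesis
    by (simp add: bellman_form_def noise_form_Pi[OF assms] Qc_def Rc_def
        matrix_vector_distribs inner_simps)
qed

lemma Rc_posdef:
  assumes "posdef R" "possemidef X"
  shows "posdef (Rc X)"
proof -
  have "possemidef (Pi22 X)"
    using assms(2) by (auto simp: possemidef_def Pi_symmetric Pi_inner intro!: sum_nonneg)
  with assms(1) show ?thesis unfolding Rc_def by (rule possemidef_add_posdef)
qed

lemma A_it_mult: "A_it Y *v x = A *v x - B *v (gain Y *v x)"
  by (simp add: A_it_def gain_def matrix_vector_distribs del: transpose_matrix_vector)

lemma A_it_eq: "transpose Y = Y \<Longrightarrow> A_it Y = Ac Y - Gc Y ** Y"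
  by (simp add: matrix_eq A_it_def Ac_def Gc_def S_it_def matrix_transpose_mul transpose_add
      matrix_vector_distribs del: transpose_matrix_vector)

text \<open>With W the inverse of \<open>Rc X\<close>, the gain term is (p + l) \<bullet> W (p + l),
  where p comes from B and l from \<open>Lc X\<close>. Its pp, ll and mixed parts are exactly the
  contributions of \<open>Gc\<close>, \<open>Hc\<close> and \<open>Ac\<close>.\<close>

lemma riccati_quadratic_form:
  assumes "posdef R" "possemidef X"
  shows "x \<bullet> (riccati X *v x) = 2 * ((A *v x) \<bullet> (X *v x)) + x \<bullet> (Qc X *v x) -
    (gain X *v x) \<bullet> (Rc X *v (gain X *v x))"
proof -
  have symX: "transpose X = X" using assms(2) by (simp add: possemidef_def)
  note pd = Rc_posdef[OF assms]
  define W where "W = matrix_inv (Rc X)"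
  have symW: "transpose W = W" using posdef_matrix_inv_symmetric[OF pd] by (simp add: W_def)
  have RW: "Rc X *v (W *v y) = y" for y
    using matrix_inv_right[OF posdef_invertible[OF pd]]
    by (simp add: W_def matrix_vector_mul_assoc)
  define p where "p = transpose B *v (X *v x)"
  define l where "l = transpose (Lc X) *v x"
  have g: "gain X *v x = W *v (p + l)"
    by (simp add: gain_def S_it_def W_def p_def l_def transpose_add matrix_transpose_mul symX
        matrix_vector_distribs del: transpose_matrix_vector)
  have lhs: "x \<bullet> (riccati X *v x) = 2 * ((Ac X *v x) \<bullet> (X *v x)) -
      (X *v x) \<bullet> (Gc X *v (X *v x)) + x \<bullet> (Hc X *v x)"
    using inner_symmetric_swap[OF symX, of x "Ac X *v x"]
      inner_symmetric_swap[OF symX, of x "Gc X *v (X *v x)"]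
    by (simp add: riccati_def matrix_vector_distribs inner_simps inner_transpose_mult
        inner_commute[of _ "X *v x"] del: transpose_matrix_vector)
  have bx: "(B *v u) \<bullet> (X *v x) = u \<bullet> p" for u
    by (simp add: p_def inner_transpose_mult del: transpose_matrix_vector)
  have lx: "x \<bullet> (Lc X *v u) = l \<bullet> u" for u
    by (simp add: l_def dot_lmul_matrix)
  have "(Ac X *v x) \<bullet> (X *v x) = (A *v x) \<bullet> (X *v x) - (W *v l) \<bullet> p"
    by (simp add: Ac_def W_def[symmetric] matrix_vector_distribs l_def[symmetric] inner_diff_left bx
        del: transpose_matrix_vector)
  moreover have "(X *v x) \<bullet> (Gc X *v (X *v x)) = p \<bullet> (W *v p)"
    by (simp add: Gc_def W_def[symmetric] matrix_vector_distribs p_def[symmetric]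
        inner_commute[of "X *v x"] bx inner_commute[of p] del: transpose_matrix_vector)
  moreover have "x \<bullet> (Hc X *v x) = x \<bullet> (Qc X *v x) - l \<bullet> (W *v l)"
    by (simp add: Hc_def W_def[symmetric] matrix_vector_distribs l_def[symmetric] inner_diff_right lx
        del: transpose_matrix_vector)
  moreover have "(W *v l) \<bullet> p = l \<bullet> (W *v p)"
    using inner_transpose_mult[of l W p] by (simp add: symW)
  moreover have "p \<bullet> (W *v l) = l \<bullet> (W *v p)" by (rule inner_symmetric_swap[OF symW])
  ultimately show ?thesis
    unfolding lhs g RW
    by (simp add: inner_simps matrix_vector_right_distrib inner_commute[of "W *v _"])
qed

text \<open>Completion of squares: \<open>gain\<close> minimises the Bellman form, and the minimum is the Riccati
  form.\<close>

lemma bellman_form_complete_square: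
  assumes "posdef R" "possemidef X"
  shows "bellman_form X x u = x \<bullet> (riccati X *v x) +
    (u - gain X *v x) \<bullet> (Rc X *v (u - gain X *v x))"
proof -
  have symX: "transpose X = X" using assms(2) by (simp add: possemidef_def)
  note pd = Rc_posdef[OF assms]
  have "Rc X *v (gain X *v x) = transpose (S_it X) *v x"
    unfolding gain_def using matrix_inv_right[OF posdef_invertible[OF pd]]
    by (simp add: matrix_vector_mul_assoc matrix_mul_assoc del: transpose_matrix_vector)
  then show ?thesis
    unfolding bellman_form_expand[OF symX] riccati_quadratic_form[OF assms]
    using pd inner_symmetric_swap[of "Rc X" "gain X *v x" u]
    by (simp add: posdef_def matrix_vector_mult_diff_distrib inner_simps
        del: transpose_matrix_vector)
qed

lemma riccati_symmetric:
  assumes "transpose Q = Q" "posdef R" "possemidef X"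
  shows "transpose (riccati X) = riccati X"
  using assms posdef_matrix_inv_symmetric[OF Rc_posdef[OF assms(2,3)]]
  by (simp add: possemidef_def riccati_def Gc_def Hc_def Qc_def transpose_add transpose_diff
      matrix_transpose_mul matrix_mul_assoc Pi_symmetric add.commute)

text \<open>The Lyapunov equation says that the Bellman form at u = gain Y x vanishes if Z stands in
  its drift term and Y in its noise term. Subtracting this from the Bellman form of Y leaves the
  drift of Y - Z, and at this control the Bellman form of Y is its Riccati form.\<close>

lemma newton_step_form:
  assumes R: "posdef R" and Y: "possemidef Y" and step: "newton_step Y Z"
  shows "2 * ((A_it Y *v x) \<bullet> ((Y - Z) *v x)) = x \<bullet> (riccati Y *v x)"
proof -
  have symY: "transpose Y = Y" using Y by (simp add: possemidef_def)
  have symZ: "transpose Z = Z" and eq: "transpose (A_it Y) ** Z + Z ** A_it Y = - Pi_it Y Y - M_it Y"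
    using step by (auto simp: newton_step_def)
  have K: "S_it Y ** matrix_inv (Rc Y) = transpose (gain Y)"
    using posdef_matrix_inv_symmetric[OF Rc_posdef[OF R Y]]
    by (simp add: gain_def matrix_transpose_mul)
  define u where "u = gain Y *v x"
  have "x \<bullet> (Pi_it Y Y *v x) = noise_form Y x u"
    unfolding Pi_it_def Pi_op_def K gain_def[symmetric] block_quadratic_form u_def
      noise_form_Pi[OF symY] ..
  moreover have "x \<bullet> (M_it Y *v x) = x \<bullet> (Q *v x) - 2 * (x \<bullet> (L *v u)) + u \<bullet> (R *v u)"
    unfolding M_it_def K gain_def[symmetric] block_quadratic_form u_def ..
  moreover have "x \<bullet> ((transpose (A_it Y) ** Z + Z ** A_it Y) *v x) =
      2 * ((A_it Y *v x) \<bullet> (Z *v x))"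
    using inner_symmetric_swap[OF symZ, of x "A_it Y *v x"]
    by (simp add: matrix_vector_distribs inner_simps inner_transpose_mult
        del: transpose_matrix_vector)
  ultimately have "2 * ((A_it Y *v x) \<bullet> (Z *v x)) + noise_form Y x u +
      x \<bullet> (Q *v x) - 2 * (x \<bullet> (L *v u)) + u \<bullet> (R *v u) = 0"
    unfolding eq by (simp add: matrix_vector_distribs inner_simps)
  then have "bellman_form Y x u = 2 * ((A_it Y *v x) \<bullet> ((Y - Z) *v x))"
    by (simp add: bellman_form_def A_it_mult u_def[symmetric] matrix_vector_mult_diff_rdistrib
        inner_diff_right)
  then show ?thesis
    using bellman_form_complete_square[OF R Y, of x u] by (simp add: u_def)
qed

text \<open>The Bellman forms of Y and Z are compared at the control gain Y x, which is optimal for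
  Y. By \<open>newton_step_form\<close> the drift of Y - Z cancels the Riccati form of Y.\<close>

lemma riccati_newton_step:
  assumes R: "posdef R" and Y: "possemidef Y" and Z: "possemidef Z" and step: "newton_step Y Z"
  shows "x \<bullet> (riccati Z *v x) = - noise_form (Y - Z) x (gain Y *v x) -
    (gain Y *v x - gain Z *v x) \<bullet> (Rc Z *v (gain Y *v x - gain Z *v x))"
  using bellman_form_complete_square[OF R Y, of x "gain Y *v x"]
    bellman_form_complete_square[OF R Z, of x "gain Y *v x"]
    bellman_form_diff[of Y x "gain Y *v x" Z] newton_step_form[OF R Y step, of x]
  by (simp add: A_it_mult)

text \<open>The same comparison for two arbitrary matrices, at the control that is optimal for Z. It
  serves with H a solution of the equation.\<close>

lemma closed_loop_riccati_difference:
  assumes R: "posdef R" and Z: "possemidef Z" and H: "possemidef H"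
  shows "2 * ((A_it Z *v x) \<bullet> ((Z - H) *v x)) =
    x \<bullet> (riccati Z *v x) - x \<bullet> (riccati H *v x) - noise_form (Z - H) x (gain Z *v x) -
    (gain Z *v x - gain H *v x) \<bullet> (Rc H *v (gain Z *v x - gain H *v x))"
  using bellman_form_complete_square[OF R Z, of x "gain Z *v x"]
    bellman_form_complete_square[OF R H, of x "gain Z *v x"]
    bellman_form_diff[of Z x "gain Z *v x" H]
  by (simp add: A_it_mult)

lemma Rc_form_nonneg:
  assumes "posdef R" "possemidef X"
  shows "0 \<le> u \<bullet> (Rc X *v u)"
  using Rc_posdef[OF assms] by (cases "u = 0") (auto simp: posdef_def less_imp_le)

section \<open>Properties inherited through one Newton step\<close>

lemma newton_step_decreasing:
  assumes "posdef R" "possemidef Y" "newton_step Y Z"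
    and "stable (A_it Y)" "possemidef (- riccati Y)"
  shows "possemidef (Y - Z)"
proof (rule lyapunov_possemidef)
  show "transpose (Y - Z) = Y - Z"
    using assms(2,3) by (simp add: possemidef_def newton_step_def transpose_diff)
  show "(A_it Y *v x) \<bullet> ((Y - Z) *v x) \<le> 0" for x
  proof -
    have "x \<bullet> (riccati Y *v x) \<le> 0"
      using assms(5) by (auto simp: possemidef_def matrix_vector_mult_minus_left)
    with newton_step_form[OF assms(1-3), of x] show ?thesis by simp
  qed
qed fact

lemma newton_step_above_solution:
  assumes R: "posdef R" and Y: "possemidef Y" and step: "newton_step Y Z"
    and H: "possemidef H" "riccati H = 0" and stab: "stable (A_it Y)" and YH: "possemidef (Y - H)"
  shows "possemidef (Z - H)"
proof (rule lyapunov_possemidef)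
  show "transpose (Z - H) = Z - H"
    using step H by (simp add: possemidef_def newton_step_def transpose_diff)
  show "(A_it Y *v x) \<bullet> ((Z - H) *v x) \<le> 0" for x
  proof -
    \<comment> \<open>The right-hand side equals the same expression with Y - Z in place of Y - H,
      so subtraction leaves the Lyapunov inequality for Z - H.\<close>
    have "2 * ((A_it Y *v x) \<bullet> ((Y - H) *v x)) \<le> x \<bullet> (riccati Y *v x)"
      using closed_loop_riccati_difference[OF R Y H(1), of x] noise_form_nonneg[OF YH]
        Rc_form_nonneg[OF R H(1)] H(2)
      by (smt (verit) inner_zero_right matrix_vector_mult_0)
    with newton_step_form[OF R Y step, of x] show ?thesis
      by (simp add: matrix_vector_mult_diff_rdistrib inner_diff_right)
  qed
qed fact

lemma newton_step_riccati_nonpos: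
  assumes "transpose Q = Q" and R: "posdef R" and Y: "possemidef Y" and Z: "possemidef Z"
    and step: "newton_step Y Z" and YZ: "possemidef (Y - Z)"
  shows "possemidef (- riccati Z)"
proof -
  have "x \<bullet> (riccati Z *v x) \<le> 0" for x
    using riccati_newton_step[OF R Y Z step, of x] noise_form_nonneg[OF YZ] Rc_form_nonneg[OF R Z]
    by (smt (verit))
  then show ?thesis
    using riccati_symmetric[OF assms(1) R Z]
    by (simp add: possemidef_def transpose_minus matrix_vector_mult_minus_left)
qed

text \<open>On an eigenvector of \<open>A_it Z\<close> with \<open>Re z \<ge> 0\<close> the Riccati form of \<open>Z\<close> must vanish, which forces
  the gains of \<open>Y\<close> and \<open>Z\<close> to agree there, so \<open>z\<close> is an eigenvalue of \<open>A_it Y\<close> too.\<close>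

lemma newton_step_stable:
  assumes R: "posdef R" and Y: "possemidef Y" and Z: "possemidef Z" and step: "newton_step Y Z"
    and YZ: "possemidef (Y - Z)" and stab: "stable (A_it Y)"
    and H: "possemidef H" "riccati H = 0" and ZH: "possemidef (Z - H)"
  shows "stable (A_it Z)"
proof -
  have "Re z < 0" if z: "z \<in> spectrum (A_it Z)" for z
  proof (rule ccontr)
    assume "\<not> Re z < 0"
    then have Re: "0 \<le> Re z" by simp
    obtain a b where ab: "a \<noteq> 0 \<or> b \<noteq> 0"
      and eigen: "A_it Z *v a = Re z *\<^sub>R a - Im z *\<^sub>R b" "A_it Z *v b = Im z *\<^sub>R a + Re z *\<^sub>R b"
      using z by (auto simp: in_spectrum_iff_real)
    have le: "2 * ((A_it Z *v x) \<bullet> ((Z - H) *v x)) \<le> x \<bullet> (riccati Z *v x)" for x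
      using closed_loop_riccati_difference[OF R Z H(1), of x] noise_form_nonneg[OF ZH]
        Rc_form_nonneg[OF R H(1)] H(2)
      by (smt (verit) inner_zero_right matrix_vector_mult_0)
    have "(A_it Z *v a) \<bullet> ((Z - H) *v a) + (A_it Z *v b) \<bullet> ((Z - H) *v b) =
        Re z * (a \<bullet> ((Z - H) *v a) + b \<bullet> ((Z - H) *v b))"
      by (rule eigenpair_form) (use ZH eigen in \<open>auto simp: possemidef_def\<close>)
    also have "\<dots> \<ge> 0" using Re ZH by (simp add: possemidef_def)
    finally have sum: "0 \<le> a \<bullet> (riccati Z *v a) + b \<bullet> (riccati Z *v b)"
      using le[of a] le[of b] by simp
    have step_form: "x \<bullet> (riccati Z *v x) \<le>
        - ((gain Y *v x - gain Z *v x) \<bullet> (Rc Z *v (gain Y *v x - gain Z *v x)))" for x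
      using riccati_newton_step[OF R Y Z step, of x] noise_form_nonneg[OF YZ, of x "gain Y *v x"]
      by simp
    \<comment> \<open>By \<open>step_form\<close> both Riccati forms are at most 0, and by
      \<open>sum\<close> they add up to at least 0. A mismatch of the gains at \<open>a\<close> or
      at \<open>b\<close> would make one of them strictly negative.\<close>
    have gains: "gain Y *v x = gain Z *v x" if "x = a \<or> x = b" for x
    proof (rule ccontr)
      assume "gain Y *v x \<noteq> gain Z *v x"
      then have "0 < (gain Y *v x - gain Z *v x) \<bullet> (Rc Z *v (gain Y *v x - gain Z *v x))"
        using Rc_posdef[OF R Z] by (simp add: posdef_def)
      then show False
        using that sum step_form[of a] step_form[of b] Rc_form_nonneg[OF R Z]
        by (smt (verit))
    qed
    have "A_it Y *v a = A_it Z *v a" "A_it Y *v b = A_it Z *v b"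
      by (simp_all add: A_it_mult gains)
    then have "z \<in> spectrum (A_it Y)"
      unfolding in_spectrum_iff_real using ab eigen by auto
    then show False using stab Re by (auto simp: stable_def)
  qed
  then show ?thesis by (auto simp: stable_def)
qed

section \<open>Passage to the limit\<close>

lemma tendsto_Pi:
  assumes "(X \<longlongrightarrow> Y) F"
  shows "((\<lambda>k. Pi11 (X k)) \<longlongrightarrow> Pi11 Y) F" "((\<lambda>k. Pi12 (X k)) \<longlongrightarrow> Pi12 Y) F"
    "((\<lambda>k. Pi22 (X k)) \<longlongrightarrow> Pi22 Y) F"
  unfolding Pi11_def Pi12_def Pi22_def
  by (intro tendsto_sum tendsto_matrix_mult tendsto_const assms)+

lemma
  assumes R: "posdef R" and lim: "X \<longlonglongrightarrow> Y" and psd: "\<And>k. possemidef (X k)"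
  shows tendsto_A_it: "(\<lambda>k. A_it (X k)) \<longlonglongrightarrow> A_it Y"
    and tendsto_riccati: "(\<lambda>k. riccati (X k)) \<longlonglongrightarrow> riccati Y"
proof -
  have Y: "possemidef Y" using possemidef_limit[OF lim psd] .
  have inv: "invertible (Rc (X k))" "invertible (Rc Y)" for k
    using posdef_invertible Rc_posdef[OF R] psd Y by blast+
  have lims: "(\<lambda>k. Lc (X k)) \<longlonglongrightarrow> Lc Y" "(\<lambda>k. Qc (X k)) \<longlonglongrightarrow> Qc Y" "(\<lambda>k. Rc (X k)) \<longlonglongrightarrow> Rc Y"
    unfolding Lc_def Qc_def Rc_def by (intro tendsto_add tendsto_const tendsto_Pi lim)+
  have W: "(\<lambda>k. matrix_inv (Rc (X k))) \<longlonglongrightarrow> matrix_inv (Rc Y)"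
    by (intro tendsto_matrix_inv lims inv)
  note intros = tendsto_add tendsto_diff tendsto_matrix_mult tendsto_transpose tendsto_const lim lims W
  show "(\<lambda>k. A_it (X k)) \<longlonglongrightarrow> A_it Y"
    unfolding A_it_def S_it_def by (intro intros)
  show "(\<lambda>k. riccati (X k)) \<longlonglongrightarrow> riccati Y"
    unfolding riccati_def Ac_def Gc_def Hc_def by (intro intros)
qed

text \<open>By \<open>newton_step_form\<close> the Riccati form of X_k carries the factor X_k -
  X_{k+1}, which tends to 0, while the closed-loop matrices converge.\<close>

lemma newton_limit_riccati:
  assumes Q: "transpose Q = Q" and R: "posdef R" and lim: "X \<longlonglongrightarrow> Y"
    and psd: "\<And>k. possemidef (X k)" and step: "\<And>k. newton_step (X k) (X (Suc k))"
  shows "riccati Y = 0"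
proof (rule symmetric_form_eq_0)
  show "transpose (riccati Y) = riccati Y"
    using riccati_symmetric[OF Q R possemidef_limit[OF lim psd]] .
  fix x
  have "(\<lambda>k. 2 * ((A_it (X k) *v x) \<bullet> ((X k - X (Suc k)) *v x))) \<longlonglongrightarrow>
      2 * ((A_it Y *v x) \<bullet> ((Y - Y) *v x))"
    by (intro tendsto_mult tendsto_inner tendsto_matrix_vector_mult tendsto_diff tendsto_const
        tendsto_A_it R lim psd LIMSEQ_Suc)
  then have "(\<lambda>k. x \<bullet> (riccati (X k) *v x)) \<longlonglongrightarrow> 0"
    by (simp add: newton_step_form[OF R psd step])
  moreover have "(\<lambda>k. x \<bullet> (riccati (X k) *v x)) \<longlonglongrightarrow> x \<bullet> (riccati Y *v x)"
    by (intro tendsto_inner tendsto_matrix_vector_mult tendsto_const tendsto_riccati R lim psd)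
  ultimately show "x \<bullet> (riccati Y *v x) = 0" using LIMSEQ_unique by blast
qed

text \<open>The decrease from \<open>X k\<close> to its successor is part of the claim at
  \<open>k\<close>, because both stability and the sign of the Riccati residual at the successor
  rest on it. The lower bound by H is passed on first, since the stability argument uses it at the
  successor.\<close>

lemma newton_invariant:
  assumes Q: "transpose Q = Q" and R: "posdef R" and H: "possemidef H" "riccati H = 0"
    and X0: "possemidef (X 0 - H)" "stable (A_it (X 0))" "possemidef (- riccati (X 0))"
    and psd: "\<And>k. possemidef (X k)" and step: "\<And>k. newton_step (X k) (X (Suc k))"
  shows "possemidef (X k - H) \<and> stable (A_it (X k)) \<and> possemidef (- riccati (X k)) \<and>
    possemidef (X k - X (Suc k))"
proof (induction k)
  case 0
  then show ?case using X0 newton_step_decreasing[OF R psd step] by blast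
next
  case (Suc k)
  then have above: "possemidef (X (Suc k) - H)"
    using newton_step_above_solution[OF R psd step H] by blast
  moreover from Suc this have "stable (A_it (X (Suc k)))"
    using newton_step_stable[OF R psd psd step _ _ H] by blast
  moreover from Suc have "possemidef (- riccati (X (Suc k)))"
    using newton_step_riccati_nonpos[OF Q R psd psd step] by blast
  ultimately show ?case using newton_step_decreasing[OF R psd step] by blast
qed

end

theorem theorem5p4:
  fixes r :: nat
    and A :: "real^'n^'n" and B :: "real^'m^'n"
    and A0 :: "nat \<Rightarrow> real^'n^'n" and B0 :: "nat \<Rightarrow> real^'m^'n"
    and Q :: "real^'n^'n" and L :: "real^'m^'n" and R :: "real^'m^'m"
    and C :: "real^'n^'p"
    and Xhat :: "real^'n^'n" and X :: "nat \<Rightarrow> real^'n^'n"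
  assumes "transpose Q = Q"
    and "posdef R"
    and "possemidef (Q - L ** matrix_inv R ** transpose L)"
    and c1: "scare.stabilizable r A B A0 B0"
    and "transpose C ** C = Q - L ** matrix_inv R ** transpose L"
    and c2: "scare.detectable r A A0 C"
    and "possemidef Xhat"
    and "scare.riccati r A B A0 B0 Q L R Xhat = 0"
    and "transpose (X 0) = X 0"
    and "possemidef (X 0 - Xhat)"
    and "stable (scare.Ac r A B A0 B0 L R (X 0) - scare.Gc r B B0 R (X 0) ** X 0)"
    and "possemidef (- scare.riccati r A B A0 B0 Q L R (X 0))"
    and "\<And>k. possemidef (X k)"
    and "\<And>k. scare.newton_step r A B A0 B0 Q L R (X k) (X (Suc k))"
  shows "(\<forall>k. possemidef (X k - X (Suc k)) \<and> possemidef (X k - Xhat) \<and>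
            possemidef (- scare.riccati r A B A0 B0 Q L R (X k))) \<and>
         (\<exists>Xp. X \<longlonglongrightarrow> Xp \<and> possemidef (Xp - Xhat) \<and>
            scare.riccati r A B A0 B0 Q L R Xp = 0 \<and>
            spectrum (scare.Ac r A B A0 B0 L R Xp - scare.Gc r B B0 R Xp ** Xp)
              \<subseteq> {z. Re z < 0} \<union> {z. Re z = 0})"
proof -
  interpret scare r A B A0 B0 Q L R .
  have "stable (A_it (X 0))"
    using assms(9,11) by (simp add: A_it_eq)
  note inv = newton_invariant[where X = X, OF assms(1,2,7,8,10) this assms(12-14)]
  obtain Xp where lim: "X \<longlonglongrightarrow> Xp"
    using possemidef_decreasing_convergent[of X] assms(13) inv by blast
  have Xp: "possemidef Xp" using possemidef_limit[OF lim assms(13)] .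
  have "possemidef (Xp - Xhat)"
    by (rule possemidef_limit[OF tendsto_diff[OF lim tendsto_const]]) (use inv in blast)
  moreover have "riccati Xp = 0"
    by (rule newton_limit_riccati[OF assms(1,2) lim assms(13,14)])
  moreover have "Re z \<le> 0" if "z \<in> spectrum (A_it Xp)" for z
    by (rule spectrum_limit_of_stable[OF tendsto_A_it[OF assms(2) lim assms(13)] _ that])
      (use inv in blast)
  \<comment> \<open>The union is the closed left half-plane, and symmetry of \<open>Xp\<close>
    identifies the matrix with \<open>A_it Xp\<close>.\<close>
  then have "spectrum (Ac Xp - Gc Xp ** Xp) \<subseteq> {z. Re z < 0} \<union> {z. Re z = 0}"
    using A_it_eq Xp by (force simp: possemidef_def)
  ultimately show ?thesis using inv lim by blast
qed

end
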